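(* Let $n\ge2$, let $K\subseteq\mathbb{R}^n$ be a compact convex set with nonempty interior, and let $\overline{B}^{\,n}$ denote the closed unit ball of $\mathbb{R}^n$. The following are equivalent: (i) $K\equiv_{\mathcal{L}_{\mathrm{aff}}}\overline{B}^{\,n}$; (ii) $K$ is affinely equivalent to $\overline{B}^{\,n}$; (iii) $K$ is a solid ellipsoid. In particular, the $\mathcal{L}_{\mathrm{aff}}$-elementary class of the closed unit ball, within compact convex bodies in $\mathbb{R}^n$, is exactly the class of solid ellipsoids.
   Context: $\mathcal{L}_{\mathrm{aff}}$ is the first-order language (with equality) having one ternary relation symbol $B$ and one binary function symbol $C_\lambda$ for each real $\lambda\in[0,1]$. A convex set $K\subseteq\mathbb{R}^n$ is regarded as an $\mathcal{L}_{\mathrm{aff}}$-structure with universe $K$, where $C_\lambda(p,q)=(1-\lambda)p+\lambda q$ and $B(a,x,b)$ holds iff $x\in[a,b]$ (the closed segment). $\equiv_{\mathcal{L}}$ denotes elementary equivalence in the language $\mathcal{L}$. Two subsets of $\mathbb{R}^n$ are affinely equivalent if some affine bijection of $\mathbb{R}^n$ maps one onto the other. A convex body is a compact convex subset of $\mathbb{R}^n$ with nonempty interior. A solid ellipsoid is by definition the image of the closed unit ball under an affine bijection of $\mathbb{R}^n$. *)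

theory Defs
  imports "HOL-Analysis.Analysis"
begin

text \<open>Indices of the function symbols \<open>C\<^sub>l\<close>: a subtype, so that every term is well-formed.\<close>

typedef weight = "{0..1::real}" morphisms real_of_weight weight_of_real
  by (rule exI [of _ 0]) simp

text \<open>\<open>Comb l s t\<close> is the term \<open>C\<^sub>l(s, t)\<close>. The other connectives and the existential
  quantifier are definable from the ones below.\<close>

datatype aff_term =
    Var nat
  | Comb weight aff_term aff_term

datatype aff_formula =
    Eq aff_term aff_term
  | Btw aff_term aff_term aff_term
  | Neg aff_formula
  | Conj aff_formula aff_formula
  | Forall nat aff_formula

primrec term_vars :: "aff_term \<Rightarrow> nat set" where
  "term_vars (Var i) = {i}"
| "term_vars (Comb l s t) = term_vars s \<union> term_vars t"

primrec free_vars :: "aff_formula \<Rightarrow> nat set" where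
  "free_vars (Eq s t) = term_vars s \<union> term_vars t"
| "free_vars (Btw s t u) = term_vars s \<union> term_vars t \<union> term_vars u"
| "free_vars (Neg \<phi>) = free_vars \<phi>"
| "free_vars (Conj \<phi> \<psi>) = free_vars \<phi> \<union> free_vars \<psi>"
| "free_vars (Forall i \<phi>) = free_vars \<phi> - {i}"

definition sentence :: "aff_formula \<Rightarrow> bool" where
  "sentence \<phi> \<longleftrightarrow> free_vars \<phi> = {}"

record 'u aff_structure =
  universe :: "'u set"
  betw :: "'u \<Rightarrow> 'u \<Rightarrow> 'u \<Rightarrow> bool"
  comb :: "weight \<Rightarrow> 'u \<Rightarrow> 'u \<Rightarrow> 'u"

primrec eval_term :: "'u aff_structure \<Rightarrow> (nat \<Rightarrow> 'u) \<Rightarrow> aff_term \<Rightarrow> 'u" where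
  "eval_term M e (Var i) = e i"
| "eval_term M e (Comb l s t) = comb M l (eval_term M e s) (eval_term M e t)"

primrec sat :: "'u aff_structure \<Rightarrow> (nat \<Rightarrow> 'u) \<Rightarrow> aff_formula \<Rightarrow> bool" where
  "sat M e (Eq s t) \<longleftrightarrow> eval_term M e s = eval_term M e t"
| "sat M e (Btw s t u) \<longleftrightarrow> betw M (eval_term M e s) (eval_term M e t) (eval_term M e u)"
| "sat M e (Neg \<phi>) \<longleftrightarrow> \<not> sat M e \<phi>"
| "sat M e (Conj \<phi> \<psi>) \<longleftrightarrow> sat M e \<phi> \<and> sat M e \<psi>"
| "sat M e (Forall i \<phi>) \<longleftrightarrow> (\<forall>x\<in>universe M. sat M (e(i := x)) \<phi>)"

text \<open>As usual in first-order logic, structures are meant to have a nonempty universe;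
  for an empty one the next definition would be vacuous.\<close>

definition models :: "'u aff_structure \<Rightarrow> aff_formula \<Rightarrow> bool" where
  "models M \<phi> \<longleftrightarrow> (\<forall>e. range e \<subseteq> universe M \<longrightarrow> sat M e \<phi>)"

definition elementarily_equivalent :: "'u aff_structure \<Rightarrow> 'v aff_structure \<Rightarrow> bool" where
  "elementarily_equivalent M N \<longleftrightarrow> (\<forall>\<phi>. sentence \<phi> \<longrightarrow> (models M \<phi> \<longleftrightarrow> models N \<phi>))"

text \<open>The structure carried by a convex set. The interpretations are given on the whole
  ambient space; convexity of \<open>K\<close> makes \<open>K\<close> closed under them.\<close>

definition convex_structure :: "'a::real_vector set \<Rightarrow> 'a aff_structure" where
  "convex_structure K =
     \<lparr>universe = K,
      betw = (\<lambda>a x b. x \<in> closed_segment a b),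
      comb = (\<lambda>l p q. (1 - real_of_weight l) *\<^sub>R p + real_of_weight l *\<^sub>R q)\<rparr>"

lemma comb_convex_structure_closed:
  assumes "convex K" "p \<in> K" "q \<in> K"
  shows "comb (convex_structure K) l p q \<in> K"
  using assms real_of_weight [of l] by (simp add: convex_structure_def convex_alt)

definition affine_bijection :: "('a::real_vector \<Rightarrow> 'a) \<Rightarrow> bool" where
  "affine_bijection f \<longleftrightarrow> bij f \<and> (\<exists>A b. linear A \<and> (\<forall>x. f x = A x + b))"

definition affinely_equivalent :: "'a::real_vector set \<Rightarrow> 'a set \<Rightarrow> bool" where
  "affinely_equivalent S T \<longleftrightarrow> (\<exists>f. affine_bijection f \<and> f ` S = T)"

definition convex_body :: "'a::euclidean_space set \<Rightarrow> bool" where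
  "convex_body K \<longleftrightarrow> compact K \<and> convex K \<and> interior K \<noteq> {}"

definition solid_ellipsoid :: "'a::euclidean_space set \<Rightarrow> bool" where
  "solid_ellipsoid E \<longleftrightarrow> (\<exists>f. affine_bijection f \<and> E = f ` cball 0 1)"

end

theory Submission
  imports Defs
begin

text \<open>Membership of \<open>c + F x\<close> in the convex set, where \<open>F\<close> is linear and given by the images of
  the basis vectors, is a first-order condition for each fixed real vector \<open>x\<close>. So for every finite
  \<open>X\<close> a sentence true in the ball asserts that there are a centre of symmetry \<open>c\<close> and a map \<open>F\<close> such
  that \<open>c + F x\<close> belongs to the set exactly for those \<open>x \<in> X\<close> that lie in the ball. If \<open>K\<close> satisfies
  all these sentences, compactness gives \<open>c\<close> and \<open>F\<close> such that \<open>x \<mapsto> c + F x\<close> maps the ball into \<open>K\<close> and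
  its complement off the interior of \<open>K\<close>. As \<open>c\<close> is a centre of symmetry, it is interior to \<open>K\<close>; hence
  \<open>F\<close> is injective, for a nonzero kernel vector would have multiples outside the ball which are sent
  to \<open>c\<close>. Therefore \<open>K\<close> is the image of the ball.\<close>

section \<open>Definable relations and their closure properties\<close>

text \<open>One formula has to serve all sets \<open>K\<close> and all assignments at once, so that
  two sets can be compared by it. The bound \<open>V\<close> on the free variables makes
  \<open>definable {}\<close> the semantic counterpart of a sentence.\<close>

definition definable :: "nat set \<Rightarrow> ('a::real_vector set \<Rightarrow> (nat \<Rightarrow> 'a) \<Rightarrow> bool) \<Rightarrow> bool" where
  "definable V P \<longleftrightarrow>
     (\<exists>\<phi>. free_vars \<phi> \<subseteq> V \<and> (\<forall>K e. sat (convex_structure K) e \<phi> \<longleftrightarrow> P K e))"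

lemma definable_mono: "definable V P \<Longrightarrow> V \<subseteq> W \<Longrightarrow> definable W P"
  unfolding definable_def by blast

lemma definable_neg:
  assumes "definable V P"
  shows "definable V (\<lambda>K e. \<not> P K e)"
proof -
  obtain \<phi> where "free_vars \<phi> \<subseteq> V" "\<forall>K e. sat (convex_structure K) e \<phi> \<longleftrightarrow> P K e"
    using assms unfolding definable_def by blast
  then show ?thesis
    unfolding definable_def by (intro exI [of _ "Neg \<phi>"]) simp
qed

lemma definable_conj:
  assumes "definable V P" "definable V Q"
  shows "definable V (\<lambda>K e. P K e \<and> Q K e)"
proof -
  obtain \<phi> \<psi> where "free_vars \<phi> \<subseteq> V" "\<forall>K e. sat (convex_structure K) e \<phi> \<longleftrightarrow> P K e"
    "free_vars \<psi> \<subseteq> V" "\<forall>K e. sat (convex_structure K) e \<psi> \<longleftrightarrow> Q K e"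
    using assms unfolding definable_def by blast
  then show ?thesis
    unfolding definable_def by (intro exI [of _ "Conj \<phi> \<psi>"]) simp
qed

lemma definable_all:
  assumes "definable (insert i V) P"
  shows "definable V (\<lambda>K e. \<forall>x\<in>K. P K (e(i := x)))"
proof -
  obtain \<phi> where "free_vars \<phi> \<subseteq> insert i V" "\<forall>K e. sat (convex_structure K) e \<phi> \<longleftrightarrow> P K e"
    using assms unfolding definable_def by blast
  then show ?thesis
    unfolding definable_def
    by (intro exI [of _ "Forall i \<phi>"]) (auto simp: convex_structure_def)
qed

lemma definable_ex:
  assumes "definable (insert i V) P"
  shows "definable V (\<lambda>K e. \<exists>x\<in>K. P K (e(i := x)))"
  using definable_neg [OF definable_all [OF definable_neg [OF assms]]] by simp

text \<open>The number of quantified points will depend on the dimension. Collecting them in one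
  assignment \<open>e'\<close> that agrees with \<open>e\<close> from \<open>m\<close> on lets the
  induction peel off one quantifier at a time.\<close>

lemma definable_ex_many:
  assumes "definable {..<m} P"
  shows "definable {}
    (\<lambda>K e. \<exists>e'. (\<forall>i<m. e' i \<in> K) \<and> (\<forall>i\<ge>m. e' i = e i) \<and> P K e')"
  using assms
proof (induction m arbitrary: P)
  case 0
  have "e' = e" if "\<forall>i. e' i = e i" for e e' :: "nat \<Rightarrow> 'a"
    using that by auto
  then have "(\<lambda>K e. \<exists>e'. (\<forall>i<0. e' i \<in> K) \<and> (\<forall>i\<ge>0. e' i = e i) \<and> P K e') = P"
    by (intro ext) auto
  with 0 show ?case by simp
next
  case (Suc m)
  have "definable {..<m} (\<lambda>K e. \<exists>x\<in>K. P K (e(m := x)))"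
    using Suc.prems by (intro definable_ex) (simp add: lessThan_Suc)
  note ex = Suc.IH [OF this]
  have "(\<exists>e'. (\<forall>i<m. e' i \<in> K) \<and> (\<forall>i\<ge>m. e' i = e i) \<and> (\<exists>x\<in>K. P K (e'(m := x)))) \<longleftrightarrow>
        (\<exists>e'. (\<forall>i<Suc m. e' i \<in> K) \<and> (\<forall>i\<ge>Suc m. e' i = e i) \<and> P K e')" for K e
  proof
    assume "\<exists>e'. (\<forall>i<m. e' i \<in> K) \<and> (\<forall>i\<ge>m. e' i = e i) \<and> (\<exists>x\<in>K. P K (e'(m := x)))"
    then obtain e' x where "\<forall>i<m. e' i \<in> K" "\<forall>i\<ge>m. e' i = e i" "x \<in> K" "P K (e'(m := x))"
      by blast
    then show "\<exists>e'. (\<forall>i<Suc m. e' i \<in> K) \<and> (\<forall>i\<ge>Suc m. e' i = e i) \<and> P K e'"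
      by (intro exI [of _ "e'(m := x)"]) (auto simp: less_Suc_eq)
  next
    assume "\<exists>e'. (\<forall>i<Suc m. e' i \<in> K) \<and> (\<forall>i\<ge>Suc m. e' i = e i) \<and> P K e'"
    then obtain e' where "\<forall>i<Suc m. e' i \<in> K" "\<forall>i\<ge>Suc m. e' i = e i" "P K e'"
      by blast
    \<comment> \<open>Resetting variable \<open>m\<close> to \<open>e m\<close> restores agreement
      with \<open>e\<close> from \<open>m\<close> on; the removed value \<open>e' m\<close> is the
      inner witness.\<close>
    then show "\<exists>e'. (\<forall>i<m. e' i \<in> K) \<and> (\<forall>i\<ge>m. e' i = e i) \<and> (\<exists>x\<in>K. P K (e'(m := x)))"
      by (intro exI [of _ "e'(m := e m)"]) (auto intro!: bexI [of _ "e' m"])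
  qed
  with ex show ?case by (simp only:)
qed

text \<open>The conjunct \<open>Q\<close> is what remains for empty \<open>X\<close>, so no formula
  for truth has to be supplied.\<close>

lemma definable_finite_all:
  assumes "finite X" "\<And>x. x \<in> X \<Longrightarrow> definable V (P x)" "definable V Q"
  shows "definable V (\<lambda>K e. Q K e \<and> (\<forall>x\<in>X. P x K e))"
  using assms
proof (induction X)
  case (insert x X)
  have "definable V (\<lambda>K e. P x K e \<and> (Q K e \<and> (\<forall>x\<in>X. P x K e)))"
    by (rule definable_conj) (use insert in auto)
  moreover have "(\<lambda>K e. P x K e \<and> Q K e \<and> (\<forall>x\<in>X. P x K e)) =
      (\<lambda>K e. Q K e \<and> (\<forall>x\<in>insert x X. P x K e))"
    by (intro ext) auto
  ultimately show ?case by simp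
qed simp

text \<open>This transfers definable facts from \<open>L\<close> to \<open>K\<close>. The assignment
  \<open>e\<close> into \<open>K\<close> rules out an empty universe, where every sentence would
  hold vacuously.\<close>

lemma elementarily_equivalent_definable:
  assumes "elementarily_equivalent (convex_structure K) (convex_structure L)"
    and "definable {} P"
    and "\<And>e. range e \<subseteq> L \<Longrightarrow> P L e"
    and "range e \<subseteq> K"
  shows "P K e"
proof -
  obtain \<phi> where \<phi>: "sentence \<phi>" "\<And>K e. sat (convex_structure K) e \<phi> \<longleftrightarrow> P K e"
    using assms(2) unfolding definable_def sentence_def by auto
  have "models (convex_structure L) \<phi>"
    using assms(3) by (simp add: models_def \<phi>(2)) (simp add: convex_structure_def)
  then have "models (convex_structure K) \<phi>"
    using assms(1) \<phi>(1) unfolding elementarily_equivalent_def by blast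
  then show ?thesis
    using assms(4) by (simp add: models_def \<phi>(2)) (simp add: convex_structure_def)
qed

section \<open>Affine combinations with real coefficients\<close>

lemma eval_term_Comb_convex_structure:
  assumes "0 \<le> t" "t \<le> 1"
  shows "eval_term (convex_structure K) e (Comb (weight_of_real t) s u) =
    (1 - t) *\<^sub>R eval_term (convex_structure K) e s + t *\<^sub>R eval_term (convex_structure K) e u"
  using assms by (simp add: convex_structure_def weight_of_real_inverse)

text \<open>Terms denote convex combinations only, so a sum with arbitrary nonnegative coefficients
  is reached after shrinking it by a factor \<open>t\<close>. The factor and the term depend on the
  coefficients alone and work for every \<open>K\<close> and \<open>e\<close>.\<close>

lemma ex_term_nonneg_combination:
  assumes "finite A" "\<And>i. i \<in> A \<Longrightarrow> 0 \<le> a i"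
  shows "\<exists>T t. 0 < t \<and> t \<le> 1 \<and> term_vars T \<subseteq> insert 0 A \<and>
    (\<forall>(K::'a::real_vector set) e. eval_term (convex_structure K) e T =
       e 0 + t *\<^sub>R (\<Sum>i\<in>A. a i *\<^sub>R (e i - e 0)))"
  using assms
proof (induction A)
  case empty
  show ?case by (intro exI [of _ "Var 0"] exI [of _ 1]) auto
next
  case (insert i A)
  then obtain T t where t: "0 < t" "t \<le> 1" and vars: "term_vars T \<subseteq> insert 0 A"
    and T: "\<And>(K::'a set) e. eval_term (convex_structure K) e T =
       e 0 + t *\<^sub>R (\<Sum>i\<in>A. a i *\<^sub>R (e i - e 0))"
    by auto
  have a: "0 \<le> a i" using insert.prems by simp
  \<comment> \<open>Combining \<open>T\<close> with \<open>Var i\<close> by weight \<open>l\<close>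
    gives the old sum the factor \<open>(1 - l) * t\<close> and \<open>e i - e 0\<close> the factor
    \<open>l\<close>. The proportion is right when \<open>l = (1 - l) * t * a i\<close>, that is
    \<open>l = t * a i / d\<close>; the new scale is \<open>t / d\<close>.\<close>
  define d where "d = 1 + t * a i"
  have d: "1 \<le> d" using a t by (simp add: d_def)
  define l where "l = t * a i / d"
  have l: "0 \<le> l" "l \<le> 1" using a t d by (simp_all add: l_def d_def divide_le_eq_1 add_pos_nonneg)
  have l1: "1 - l = 1 / d" using d by (simp add: l_def d_def field_simps)
  have "eval_term (convex_structure K) e (Comb (weight_of_real l) T (Var i)) =
       e 0 + (t / d) *\<^sub>R (\<Sum>i\<in>insert i A. a i *\<^sub>R (e i - e 0))" for K :: "'a set" and e
  proof -
    define S where "S = (\<Sum>i\<in>A. a i *\<^sub>R (e i - e 0))"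
    have "eval_term (convex_structure K) e (Comb (weight_of_real l) T (Var i)) =
        (1 - l) *\<^sub>R (e 0 + t *\<^sub>R S) + l *\<^sub>R e i"
      by (simp only: eval_term_Comb_convex_structure [OF l] T S_def eval_term.simps(1))
    also have "\<dots> = e 0 + ((1 - l) * t) *\<^sub>R S + l *\<^sub>R (e i - e 0)"
      by (simp add: algebra_simps)
    also have "\<dots> = e 0 + (t / d) *\<^sub>R (a i *\<^sub>R (e i - e 0) + S)"
      by (simp add: l1 scaleR_add_right) (simp add: l_def)
    finally show ?thesis using insert.hyps by (simp add: S_def)
  qed
  moreover have "0 < t / d" "t / d \<le> 1" using t d by (auto simp: field_simps)
  ultimately show ?case
    using vars by (intro exI [of _ "Comb (weight_of_real l) T (Var i)"] exI [of _ "t / d"]) auto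
qed

text \<open>Negative coefficients are moved to the other side of the equation, and both sides are
  brought to a common scale.\<close>

lemma definable_affine_relation:
  assumes "finite A"
  shows "definable (insert 0 A)
    (\<lambda>(K::'a::real_vector set) e. (\<Sum>i\<in>A. a i *\<^sub>R (e i - e 0)) = 0)"
proof -
  define P where "P = {i\<in>A. 0 \<le> a i}"
  define N where "N = {i\<in>A. a i < 0}"
  have fin: "finite P" "finite N" using assms by (auto simp: P_def N_def)
  have pos: "0 \<le> a i" if "i \<in> P" for i using that by (simp add: P_def)
  have neg: "0 \<le> - a i" if "i \<in> N" for i using that by (simp add: N_def)
  have "A = P \<union> N" "P \<inter> N = {}" by (auto simp: P_def N_def)
  then have split: "(\<Sum>i\<in>A. a i *\<^sub>R (e i - e 0)) =
      (\<Sum>i\<in>P. a i *\<^sub>R (e i - e 0)) - (\<Sum>i\<in>N. (- a i) *\<^sub>R (e i - e 0))" for e :: "nat \<Rightarrow> 'a"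
    using sum.union_disjoint [OF fin, of "\<lambda>i. a i *\<^sub>R (e i - e 0)"]
    unfolding scaleR_minus_left sum_negf by simp
  obtain T t where t: "0 < t" "t \<le> 1" and "term_vars T \<subseteq> insert 0 P"
    and T: "\<And>(K::'a set) e. eval_term (convex_structure K) e T =
       e 0 + t *\<^sub>R (\<Sum>i\<in>P. a i *\<^sub>R (e i - e 0))"
    using ex_term_nonneg_combination [OF fin(1), of a, where ?'a = 'a] pos by auto
  obtain U u where u: "0 < u" "u \<le> 1" and "term_vars U \<subseteq> insert 0 N"
    and U: "\<And>(K::'a set) e. eval_term (convex_structure K) e U =
       e 0 + u *\<^sub>R (\<Sum>i\<in>N. (- a i) *\<^sub>R (e i - e 0))"
    using ex_term_nonneg_combination [OF fin(2), of "\<lambda>i. - a i", where ?'a = 'a] neg by auto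
  define \<phi> where "\<phi> = Eq (Comb (weight_of_real u) (Var 0) T) (Comb (weight_of_real t) (Var 0) U)"
  have "free_vars \<phi> \<subseteq> insert 0 A"
    using \<open>term_vars T \<subseteq> _\<close> \<open>term_vars U \<subseteq> _\<close> by (auto simp: \<phi>_def P_def N_def)
  moreover have "sat (convex_structure K) e \<phi> \<longleftrightarrow> (\<Sum>i\<in>A. a i *\<^sub>R (e i - e 0)) = 0"
    for K :: "'a set" and e
  proof -
    define x where "x = (\<Sum>i\<in>P. a i *\<^sub>R (e i - e 0))"
    define y where "y = (\<Sum>i\<in>N. (- a i) *\<^sub>R (e i - e 0))"
    have "sat (convex_structure K) e \<phi> \<longleftrightarrow>
        (1 - u) *\<^sub>R e 0 + u *\<^sub>R (e 0 + t *\<^sub>R x) = (1 - t) *\<^sub>R e 0 + t *\<^sub>R (e 0 + u *\<^sub>R y)"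
      using t u
      by (simp add: \<phi>_def eval_term_Comb_convex_structure T U x_def y_def del: eval_term.simps(2))
    also have "\<dots> \<longleftrightarrow> (t * u) *\<^sub>R x = (t * u) *\<^sub>R y"
      by (simp add: algebra_simps)
    also have "\<dots> \<longleftrightarrow> x - y = 0" using t u by simp
    finally show ?thesis by (simp add: split x_def y_def)
  qed
  ultimately show ?thesis unfolding definable_def by blast
qed

text \<open>With arbitrary real coefficients the point need not be the value of a term. Membership
  is therefore expressed by an existential quantifier over \<open>K\<close> and an affine
  relation.\<close>

lemma definable_affine_combination_mem:
  assumes "finite A" "0 \<notin> A"
  shows "definable (insert 0 A)
    (\<lambda>(K::'a::real_vector set) e. e 0 + (\<Sum>i\<in>A. a i *\<^sub>R (e i - e 0)) \<in> K)"
proof -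
  obtain m where m: "m \<notin> insert 0 A"
    using assms ex_new_if_finite [of "insert 0 A"] by (auto simp: infinite_UNIV_nat)
  \<comment> \<open>Coefficient \<open>- 1\<close> at the fresh variable \<open>m\<close> makes the
    relation say that the combination minus the quantified point is zero.\<close>
  define b where "b = (\<lambda>i. if i = m then - 1 else a i)"
  have "definable (insert m (insert 0 A))
      (\<lambda>(K::'a set) e. (\<Sum>i\<in>insert m A. b i *\<^sub>R (e i - e 0)) = 0)"
    using definable_affine_relation [of "insert m A" b] assms by (simp add: insert_commute)
  from definable_ex [OF this]
  have "definable (insert 0 A)
      (\<lambda>(K::'a set) e. \<exists>x\<in>K. (\<Sum>i\<in>insert m A. b i *\<^sub>R ((e(m := x)) i - (e(m := x)) 0)) = 0)" .
  moreover have "(\<Sum>i\<in>insert m A. b i *\<^sub>R ((e(m := x)) i - (e(m := x)) 0)) =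
      (e 0 + (\<Sum>i\<in>A. a i *\<^sub>R (e i - e 0))) - x" for e :: "nat \<Rightarrow> 'a" and x
  proof -
    have "(\<Sum>i\<in>A. b i *\<^sub>R ((e(m := x)) i - (e(m := x)) 0)) = (\<Sum>i\<in>A. a i *\<^sub>R (e i - e 0))"
      using m by (intro sum.cong) (auto simp: b_def)
    then show ?thesis using m assms by (simp add: b_def)
  qed
  ultimately show ?thesis by (simp del: fun_upd_apply)
qed

text \<open>The reflection of \<open>x\<close> in \<open>e 0\<close> is the affine combination
  \<open>e 0 + (- 1) *\<^sub>R (x - e 0)\<close>, with \<open>x\<close> as variable 1.\<close>

lemma definable_centre:
  "definable {0} (\<lambda>(K::'a::real_vector set) e. \<forall>x\<in>K. 2 *\<^sub>R e 0 - x \<in> K)"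
proof -
  have "definable (insert 1 {0}) (\<lambda>(K::'a set) e. e 0 + (\<Sum>i\<in>{1}. (- 1) *\<^sub>R (e i - e 0)) \<in> K)"
    using definable_affine_combination_mem [of "{1}" "\<lambda>_. - 1"] by (simp add: insert_commute)
  from definable_all [OF this] show ?thesis by (simp add: scaleR_2 algebra_simps)
qed

section \<open>Finite approximations to a chart and their limit\<close>

text \<open>Variable 0 stands for the centre \<open>c\<close> and variables 1 to \<open>n\<close>
  for the points \<open>c + F b\<close> with \<open>b\<close> in the basis. The ball satisfies the
  resulting sentence with centre 0 and \<open>F\<close> the identity. That the points
  \<open>c + F b\<close> lie in \<open>K\<close> comes from the range of the quantifiers; it will
  bound \<open>F\<close>.\<close>

lemma finite_approximate_chart:
  fixes K :: "'a::euclidean_space set"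
  assumes eq: "elementarily_equivalent (convex_structure K) (convex_structure (cball (0::'a) 1))"
    and "K \<noteq> {}" "finite (X :: 'a set)"
  shows "\<exists>c\<in>K. \<exists>F. linear F \<and> (\<forall>b\<in>Basis. c + F b \<in> K) \<and> (\<forall>x\<in>K. 2 *\<^sub>R c - x \<in> K) \<and>
    (\<forall>x\<in>X. c + F x \<in> K \<longleftrightarrow> norm x \<le> 1)"
proof -
  define n where "n = DIM('a)"
  obtain h where h: "bij_betw h {1..n} (Basis :: 'a set)"
    using ex_bij_betw_nat_finite_1 [OF finite_Basis] unfolding n_def by blast
  define F where "F = (\<lambda>(e :: nat \<Rightarrow> 'a) x. \<Sum>i\<in>{1..n}. (x \<bullet> h i) *\<^sub>R (e i - e 0))"
  define Q where "Q = (\<lambda>(K::'a set) e. (\<forall>x\<in>K. 2 *\<^sub>R e 0 - x \<in> K) \<and>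
    (\<forall>x\<in>X. e 0 + F e x \<in> K \<longleftrightarrow> norm x \<le> 1))"
  have V: "insert 0 {1..n} \<subseteq> {..<Suc n}" "{0} \<subseteq> {..<Suc n}" by auto
  have mem: "definable {..<Suc n} (\<lambda>(K::'a set) e. e 0 + F e x \<in> K)" for x
    unfolding F_def by (intro definable_mono [OF definable_affine_combination_mem V(1)]) auto
  have "definable {..<Suc n} (\<lambda>(K::'a set) e. e 0 + F e x \<in> K \<longleftrightarrow> norm x \<le> 1)" for x
  proof (cases "norm x \<le> 1")
    case True
    then show ?thesis using mem [of x] by simp
  next
    case False
    then show ?thesis using definable_neg [OF mem [of x]] by simp
  qed
  then have "definable {..<Suc n} Q"
    unfolding Q_def
    using \<open>finite X\<close> by (intro definable_finite_all definable_mono [OF definable_centre V(2)])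
  note def = definable_ex_many [OF this]
  obtain k where "k \<in> K" using \<open>K \<noteq> {}\<close> by blast
  have "\<exists>e'. (\<forall>i<Suc n. e' i \<in> cball 0 1) \<and> (\<forall>i\<ge>Suc n. e' i = e i) \<and> Q (cball 0 1) e'" for e
  proof (intro exI conjI)
    \<comment> \<open>The origin and the basis vectors themselves make \<open>F e'\<close> the
      identity; beyond \<open>n\<close> the values of \<open>e\<close> are kept, as the quantified
      block requires.\<close>
    define e' where "e' = (\<lambda>i. if i = 0 then 0 else if i \<le> n then h i else e i)"
    have "h i \<in> Basis" if "i \<in> {1..n}" for i
      using h that by (auto simp: bij_betw_def)
    then show "\<forall>i<Suc n. e' i \<in> cball 0 1" by (auto simp: e'_def Suc_le_eq)
    show "\<forall>i\<ge>Suc n. e' i = e i" by (auto simp: e'_def)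
    have "F e' x = x" for x
    proof -
      have "F e' x = (\<Sum>i\<in>{1..n}. (x \<bullet> h i) *\<^sub>R h i)"
        by (auto simp: F_def e'_def)
      also have "\<dots> = (\<Sum>b\<in>Basis. (x \<bullet> b) *\<^sub>R b)"
        by (rule sum.reindex_bij_betw [OF h])
      finally show ?thesis by (simp add: euclidean_representation)
    qed
    then show "Q (cball 0 1) e'" by (auto simp: Q_def e'_def)
  qed
  \<comment> \<open>Any assignment into \<open>K\<close> will do here; a constant one exists because
    \<open>K\<close> is nonempty.\<close>
  from elementarily_equivalent_definable [OF eq def this, of "\<lambda>_. k"] \<open>k \<in> K\<close>
  obtain e where e: "\<forall>i<Suc n. e i \<in> K" and Q: "Q K e" by auto
  have "linear (F e)"
    unfolding F_def by (intro linearI) (auto simp: inner_add_left scaleR_add_left sum.distrib scaleR_sum_right)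
  moreover have "e 0 + F e b \<in> K" if "b \<in> Basis" for b
  proof -
    have "b \<in> h ` {1..n}" using that by (simp only: bij_betw_imp_surj_on [OF h])
    then obtain i where i: "i \<in> {1..n}" "b = h i" by blast
    have "b \<bullet> h j = (if j = i then 1 else 0)" if "j \<in> {1..n}" for j
    proof -
      have "h i \<in> Basis" "h j \<in> Basis" "h i = h j \<longleftrightarrow> i = j"
        using h i(1) that by (auto simp only: bij_betw_def inj_on_eq_iff)
      then show ?thesis by (auto simp: i(2) inner_Basis)
    qed
    then have "F e b = (\<Sum>j\<in>{1..n}. if j = i then e j - e 0 else 0)"
      unfolding F_def by (intro sum.cong) auto
    then have "e 0 + F e b = e i" using i by (simp add: sum.delta)
    then show ?thesis using e i by auto
  qed
  ultimately show ?thesis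
    using e Q unfolding Q_def by blast
qed

text \<open>The finite approximations converge along a countable dense set of test points. The limit
  only keeps the closed conditions, so points outside the ball are merely known to avoid the
  interior of \<open>K\<close>.\<close>

lemma limit_chart:
  fixes K :: "'a::euclidean_space set"
  assumes eq: "elementarily_equivalent (convex_structure K) (convex_structure (cball (0::'a) 1))"
    and "K \<noteq> {}" "compact K"
  shows "\<exists>c\<in>K. \<exists>F::'a \<Rightarrow> 'a. linear F \<and> (\<forall>x\<in>K. 2 *\<^sub>R c - x \<in> K) \<and>
    (\<forall>x. norm x \<le> 1 \<longrightarrow> c + F x \<in> K) \<and> (\<forall>x. 1 < norm x \<longrightarrow> c + F x \<notin> interior K)"
proof -
  obtain D :: "'a set" where D: "countable D" and dense: "\<And>U. open U \<Longrightarrow> U \<noteq> {} \<Longrightarrow> \<exists>d\<in>D. d \<in> U"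
    using countable_dense_exists by blast
  have "D \<noteq> {}" using dense [of UNIV] by auto
  have range_d: "range (from_nat_into D) = D"
    using D \<open>D \<noteq> {}\<close> by (simp add: range_from_nat_into)
  \<comment> \<open>The \<open>k\<close>-th approximation is tested on the entries 0 to
    \<open>k\<close> of an enumeration of \<open>D\<close>, so each point of \<open>D\<close> is
    tested by all but finitely many approximations.\<close>
  have "\<exists>p. fst p \<in> K \<and> linear (snd p) \<and> (\<forall>b\<in>Basis. fst p + snd p b \<in> K) \<and>
      (\<forall>x\<in>K. 2 *\<^sub>R fst p - x \<in> K) \<and>
      (\<forall>x\<in>from_nat_into D ` {..k}. fst p + snd p x \<in> K \<longleftrightarrow> norm x \<le> 1)" for k :: nat
    unfolding split_paired_Ex fst_conv snd_conv
    by (use finite_approximate_chart [OF assms(1,2), of "from_nat_into D ` {..k}"] in blast)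
  then obtain p where p: "\<And>k. fst (p k) \<in> K \<and> linear (snd (p k)) \<and>
      (\<forall>b\<in>Basis. fst (p k) + snd (p k) b \<in> K) \<and> (\<forall>x\<in>K. 2 *\<^sub>R fst (p k) - x \<in> K) \<and>
      (\<forall>x\<in>from_nat_into D ` {..k}. fst (p k) + snd (p k) x \<in> K \<longleftrightarrow> norm x \<le> 1)"
    by metis
  define c where "c = (\<lambda>k. fst (p k))"
  \<comment> \<open>As bounded linear functions the maps live in a normed space whose closed balls
    are compact.\<close>
  define F where "F = (\<lambda>k. Blinfun (snd (p k)))"
  have F: "blinfun_apply (F k) = snd (p k)" for k
    unfolding F_def using p by (intro bounded_linear_Blinfun_apply linear_conv_bounded_linear [THEN iffD1]) auto
  have c_in: "c k \<in> K" and F_in: "\<And>b. b \<in> Basis \<Longrightarrow> c k + F k b \<in> K"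
    and sym: "\<And>x. x \<in> K \<Longrightarrow> 2 *\<^sub>R c k - x \<in> K"
    and test: "\<And>j. j \<le> k \<Longrightarrow>
      c k + F k (from_nat_into D j) \<in> K \<longleftrightarrow> norm (from_nat_into D j) \<le> 1" for k
    using p [of k] by (auto simp: c_def F)
  obtain M where M: "\<And>x. x \<in> K \<Longrightarrow> norm x \<le> M"
    using \<open>compact K\<close> compact_imp_bounded bounded_iff by metis
  \<comment> \<open>\<open>F k b\<close> is a difference of two points of \<open>K\<close>, hence of
    norm at most \<open>2 * M\<close>; expanding \<open>x\<close> in the basis adds up
    \<open>DIM('a)\<close> such terms.\<close>
  have "norm (F k) \<le> real DIM('a) * (2 * M)" for k
  proof (rule norm_blinfun_bound)
    have "0 \<le> M" using M [OF c_in] norm_ge_zero order_trans by blast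
    then show "0 \<le> real DIM('a) * (2 * M)" by simp
    fix x
    have "norm (F k b) \<le> 2 * M" if "b \<in> Basis" for b
      using norm_triangle_ineq4 [of "c k + F k b" "c k"] M [OF F_in [OF that, of k]] M [OF c_in [of k]]
      by simp
    then have *: "norm ((x \<bullet> b) *\<^sub>R F k b) \<le> norm x * (2 * M)" if "b \<in> Basis" for b
      using that Basis_le_norm [OF that, of x] by (simp add: mult_mono)
    have "F k x = F k (\<Sum>b\<in>Basis. (x \<bullet> b) *\<^sub>R b)" by (simp add: euclidean_representation)
    also have "\<dots> = (\<Sum>b\<in>Basis. (x \<bullet> b) *\<^sub>R F k b)"
      by (simp add: blinfun.sum_right blinfun.scaleR_right)
    also have "norm \<dots> \<le> real DIM('a) * (norm x * (2 * M))"
      using * by (rule sum_norm_bound)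
    finally show "norm (F k x) \<le> real DIM('a) * (2 * M) * norm x" by (simp add: mult_ac)
  qed
  then have mem: "\<forall>k. (c k, F k) \<in> K \<times> cball 0 (real DIM('a) * (2 * M))"
    using c_in by simp
  have "seq_compact (K \<times> cball (0 :: 'a \<Rightarrow>\<^sub>L 'a) (real DIM('a) * (2 * M)))"
    using \<open>compact K\<close> by (simp add: compact_Times compact_imp_seq_compact)
  then obtain l r where "l \<in> K \<times> cball 0 (real DIM('a) * (2 * M))" "strict_mono r"
    and lim: "((\<lambda>k. (c k, F k)) \<circ> r) \<longlonglongrightarrow> l"
    using mem by (rule seq_compactE)
  define c' where "c' = fst l"
  define F' where "F' = snd l"
  have "c' \<in> K" using \<open>l \<in> _\<close> by (auto simp: c'_def)
  have lim_c: "(\<lambda>k. c (r k)) \<longlonglongrightarrow> c'" and lim_F: "(\<lambda>k. F (r k)) \<longlonglongrightarrow> F'"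
    using tendsto_fst [OF lim] tendsto_snd [OF lim] by (simp_all add: c'_def F'_def o_def)
  have lim_f: "(\<lambda>k. c (r k) + F (r k) x) \<longlonglongrightarrow> c' + F' x" for x
    by (intro tendsto_intros lim_c lim_F)
  have "closed K" using \<open>compact K\<close> by (rule compact_imp_closed)
  have ev: "\<forall>\<^sub>F k in sequentially. c (r k) + F (r k) x \<in> K \<longleftrightarrow> norm x \<le> 1" if "x \<in> D" for x
  proof -
    have "x \<in> range (from_nat_into D)" using that by (simp only: range_d)
    then obtain j where x: "x = from_nat_into D j" by blast
    show ?thesis
    proof (rule eventually_sequentiallyI)
      fix k assume "j \<le> k"
      then have "j \<le> r k" using strict_mono_imp_increasing [OF \<open>strict_mono r\<close>] le_trans by blast
      then show "c (r k) + F (r k) x \<in> K \<longleftrightarrow> norm x \<le> 1" unfolding x by (rule test)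
    qed
  qed
  have cont: "continuous_on UNIV (\<lambda>x. c' + F' x)"
    by (intro continuous_intros)
  have in_D: "c' + F' x \<in> K" if "x \<in> D" "norm x \<le> 1" for x
  proof (rule Lim_in_closed_set [OF \<open>closed K\<close> _ _ lim_f])
    show "\<forall>\<^sub>F k in sequentially. c (r k) + F (r k) x \<in> K"
      using ev [OF that(1)] that(2) by simp
  qed simp
  have "2 *\<^sub>R c' - x \<in> K" if "x \<in> K" for x
  proof (rule Lim_in_closed_set [OF \<open>closed K\<close>])
    show "(\<lambda>k. 2 *\<^sub>R c (r k) - x) \<longlonglongrightarrow> 2 *\<^sub>R c' - x"
      by (intro tendsto_intros lim_c)
  qed (use sym that in auto)
  moreover have "c' + F' x \<in> K" if "norm x \<le> 1" for x
  proof (rule ccontr)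
    assume out: "c' + F' x \<notin> K"
    \<comment> \<open>Missing the closed set \<open>K\<close> is an open condition. It would hold
      near \<open>x\<close>, hence at some test point of the open ball, against \<open>in_D\<close>;
      approximation from the open ball also covers \<open>x\<close> on the sphere.\<close>
    define U where "U = (\<lambda>x. c' + F' x) -` (- K)"
    have "open U"
      unfolding U_def using \<open>closed K\<close> cont by (simp add: open_vimage open_Compl)
    moreover have "x \<in> closure (ball 0 1)" using that by (simp add: closure_ball)
    moreover have "x \<in> U" using out by (simp add: U_def)
    ultimately have "U \<inter> ball 0 1 \<noteq> {}"
      using open_Int_closure_eq_empty by blast
    then obtain d where "d \<in> D" "d \<in> U \<inter> ball 0 1"
      using dense \<open>open U\<close> by (metis open_Int open_ball)
    then show False using in_D [of d] by (auto simp: U_def)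
  qed
  moreover have "c' + F' x \<notin> interior K" if "1 < norm x" for x
  proof
    assume "c' + F' x \<in> interior K"
    \<comment> \<open>Both conditions on \<open>x\<close> are open and so shared by a test point
      \<open>d\<close>. Convergence puts the approximate images of \<open>d\<close> into
      \<open>K\<close>, although \<open>d\<close> lies outside the ball.\<close>
    then have "x \<in> (\<lambda>x. c' + F' x) -` interior K \<inter> - cball 0 1" using that by simp
    moreover have "open ((\<lambda>x. c' + F' x) -` interior K \<inter> - cball 0 1)"
      using cont by (intro open_Int open_vimage) auto
    ultimately obtain d where "d \<in> D" and d: "c' + F' d \<in> interior K" "\<not> norm d \<le> 1"
      using dense by fastforce
    have "\<forall>\<^sub>F k in sequentially. c (r k) + F (r k) d \<in> interior K"
      using topological_tendstoD [OF lim_f open_interior d(1)] .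
    with ev [OF \<open>d \<in> D\<close>] have "\<forall>\<^sub>F k in sequentially. False"
      by eventually_elim (use d interior_subset in blast)
    then show False by simp
  qed
  moreover have "linear F'"
    by (simp add: blinfun.bounded_linear_right bounded_linear.linear)
  ultimately show ?thesis using \<open>c' \<in> K\<close> by blast
qed

section \<open>From the chart to an ellipsoid\<close>

text \<open>Once the limit chart is known to be bijective, every interior point of \<open>K\<close>
  has a preimage, which cannot lie outside the ball. So the image of the ball contains the interior,
  and also its closure, which is \<open>K\<close> by convexity.\<close>

lemma elementarily_equivalent_ball_imp_ellipsoid:
  fixes K :: "'a::euclidean_space set"
  assumes body: "convex_body K"
    and eq: "elementarily_equivalent (convex_structure K) (convex_structure (cball (0::'a) 1))"
  shows "solid_ellipsoid K"
proof -
  have K: "compact K" "convex K" "interior K \<noteq> {}"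
    using body by (auto simp: convex_body_def)
  have "K \<noteq> {}" using K(3) by auto
  obtain c and F :: "'a \<Rightarrow> 'a" where "c \<in> K" "linear F" and sym: "\<And>x. x \<in> K \<Longrightarrow> 2 *\<^sub>R c - x \<in> K"
    and ins: "\<And>x. norm x \<le> 1 \<Longrightarrow> c + F x \<in> K"
    and out: "\<And>x. 1 < norm x \<Longrightarrow> c + F x \<notin> interior K"
    using limit_chart [OF eq \<open>K \<noteq> {}\<close> K(1)] by blast
  obtain x where x: "x \<in> interior K" using K(3) by blast
  have "c \<in> interior K"
  proof (cases "x = c")
    case False
    \<comment> \<open>\<open>c\<close> is the midpoint of the interior point \<open>x\<close> and
      its reflection in \<open>K\<close>, and the open segment between these two consists of
      interior points.\<close>
    have "2 *\<^sub>R c - x \<in> closure K"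
      using sym x interior_subset closure_subset by blast
    from in_interior_closure_convex_segment [OF K(2) x this]
    have "open_segment x (2 *\<^sub>R c - x) \<subseteq> interior K" .
    moreover have "c = midpoint x (2 *\<^sub>R c - x)"
      by (simp add: midpoint_def)
    moreover have "x \<noteq> 2 *\<^sub>R c - x"
      using False by (auto simp: scaleR_2 algebra_simps simp flip: scaleR_2)
    ultimately show ?thesis
      by (metis midpoint_in_open_segment subsetD)
  qed (use x in simp)
  have "v = 0" if "F v = 0" for v
  proof (rule ccontr)
    assume "v \<noteq> 0"
    then have "c + F ((2 / norm v) *\<^sub>R v) \<notin> interior K" by (intro out) simp
    then show False using \<open>c \<in> interior K\<close> that by (simp add: linear_cmul [OF \<open>linear F\<close>])
  qed
  then have "inj F" using linear_injective_0 [OF \<open>linear F\<close>] by blast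
  then have "bij F" using \<open>linear F\<close> by (simp add: bij_def linear_injective_imp_surjective)
  define f where "f = (\<lambda>x. F x + c)"
  have "bij ((+) c \<circ> F)" using \<open>bij F\<close> by (intro bij_comp) auto
  then have "bij f" by (simp add: f_def comp_def add.commute)
  then have "affine_bijection f"
    unfolding affine_bijection_def f_def using \<open>linear F\<close> by blast
  moreover have "K = f ` cball 0 1"
  proof
    show "f ` cball 0 1 \<subseteq> K" using ins by (auto simp: f_def add.commute)
    have "interior K \<subseteq> f ` cball 0 1"
    proof
      fix y assume y: "y \<in> interior K"
      obtain x where "y = f x" using \<open>bij f\<close> by (metis bij_pointE)
      then show "y \<in> f ` cball 0 1" using y out [of x] by (force simp: f_def add.commute)
    qed
    moreover have "compact (f ` cball 0 1)"
      unfolding f_def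
      by (intro compact_continuous_image continuous_intros linear_continuous_on) 
         (use \<open>linear F\<close> in \<open>auto simp: linear_conv_bounded_linear\<close>)
    ultimately have "closure (interior K) \<subseteq> f ` cball 0 1"
      by (simp add: closure_minimal compact_imp_closed)
    then show "K \<subseteq> f ` cball 0 1"
      using convex_closure_interior [OF K(2,3)] closure_subset by blast
  qed
  ultimately show ?thesis unfolding solid_ellipsoid_def by blast
qed

section \<open>Affine bijections, ellipsoids and isomorphism invariance\<close>

lemma affine_bijection_inv:
  fixes f :: "'a::euclidean_space \<Rightarrow> 'a"
  assumes "affine_bijection f"
  shows "affine_bijection (inv f)"
proof -
  obtain A b where "bij f" and A: "linear A" and f: "\<And>x. f x = A x + b"
    using assms unfolding affine_bijection_def by blast
  have "inj A" using \<open>bij f\<close> f by (simp add: bij_def inj_def)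
  then obtain B where B: "linear B" "\<And>x. A (B x) = x" "\<And>x. B (A x) = x"
    using linear_injective_isomorphism [OF A] by auto
  have "inv f y = B y + (- B b)" for y
  proof (rule inv_f_eq)
    show "inj f" using \<open>bij f\<close> by (rule bij_is_inj)
    show "f (B y + - B b) = y"
      using B A by (simp add: f linear_diff)
  qed
  then show ?thesis
    unfolding affine_bijection_def using bij_imp_bij_inv [OF \<open>bij f\<close>] B(1) by blast
qed

lemma bij_image_eq_inv_image_iff:
  assumes "bij f"
  shows "f ` S = T \<longleftrightarrow> S = inv f ` T"
  using image_inv_f_f [OF bij_is_inj [OF assms]] image_f_inv_f [OF bij_is_surj [OF assms]] by metis

text \<open>The two notions use maps in opposite directions, one onto the ball and one from it;
  inverse affine bijections translate between them.\<close>

lemma affinely_equivalent_ball_iff: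
  "affinely_equivalent K (cball (0::'a::euclidean_space) 1) \<longleftrightarrow> solid_ellipsoid K"
proof
  assume "affinely_equivalent K (cball 0 1)"
  then obtain f where "affine_bijection f" "f ` K = cball 0 1"
    unfolding affinely_equivalent_def by blast
  then show "solid_ellipsoid K"
    unfolding solid_ellipsoid_def
    using affine_bijection_inv bij_image_eq_inv_image_iff [of f K] affine_bijection_def by blast
next
  assume "solid_ellipsoid K"
  then obtain f where f: "affine_bijection f" "K = f ` cball 0 1"
    unfolding solid_ellipsoid_def by blast
  then have "inv f ` K = cball 0 1"
    using bij_image_eq_inv_image_iff [of f "cball 0 1" K] affine_bijection_def by blast
  then show "affinely_equivalent K (cball 0 1)"
    unfolding affinely_equivalent_def using affine_bijection_inv [OF f(1)] by blast
qed

text \<open>An affine bijection commutes with convex combinations, preserves and reflects segments,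
  and carries the universe \<open>K\<close> onto its image. It is thus an isomorphism of
  structures.\<close>

lemma sat_affine_bijection:
  assumes "affine_bijection f"
  shows "sat (convex_structure (f ` K)) (f \<circ> e) \<phi> \<longleftrightarrow> sat (convex_structure K) e \<phi>"
proof -
  obtain A b where "bij f" and A: "linear A" and f: "\<And>x. f x = A x + b"
    using assms unfolding affine_bijection_def by blast
  have inj: "f x = f y \<longleftrightarrow> x = y" for x y
    using \<open>bij f\<close> by (simp add: bij_is_inj inj_eq)
  have comb: "(1 - t) *\<^sub>R f x + t *\<^sub>R f y = f ((1 - t) *\<^sub>R x + t *\<^sub>R y)" for t x y
    by (simp add: f linear_add [OF A] linear_cmul [OF A] linear_diff [OF A] algebra_simps)
  have betw: "betw (convex_structure S) x y z \<longleftrightarrow> y \<in> closed_segment x z" for S :: "'a set" and x y z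
    by (simp add: convex_structure_def)
  have univ: "universe (convex_structure S) = S" for S :: "'a set"
    by (simp add: convex_structure_def)
  have eval: "eval_term (convex_structure (f ` K)) (\<lambda>i. f (e i)) s = f (eval_term (convex_structure K) e s)"
    for e s by (induction s) (simp_all add: convex_structure_def comb)
  have segment: "f x \<in> closed_segment (f y) (f z) \<longleftrightarrow> x \<in> closed_segment y z" for x y z
    by (simp add: in_segment comb inj)
  show ?thesis
  proof (induction \<phi> arbitrary: e)
    case (Btw s t u)
    then show ?case
      by (simp add: eval betw segment)
  next
    case (Forall i \<phi>)
    \<comment> \<open>Updating the transported assignment is transporting an updated one, so a
      quantifier over the image amounts to one over \<open>K\<close>.\<close>
    have "(f \<circ> e)(i := f x) = f \<circ> e(i := x)" for x by auto
    then have "sat (convex_structure (f ` K)) ((f \<circ> e)(i := f x)) \<phi> \<longleftrightarrow>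
        sat (convex_structure K) (e(i := x)) \<phi>" for x
      using Forall.IH by (simp only:)
    then show ?case by (simp only: sat.simps univ ball_simps)
  qed (simp_all add: eval eval [folded o_def] inj)
qed

text \<open>The assignments into the image of \<open>K\<close> are exactly the
  \<open>f \<circ> e\<close> with \<open>e\<close> into \<open>K\<close>, so the isomorphism matches
  truth in both structures.\<close>

lemma affinely_equivalent_imp_elementarily_equivalent:
  assumes "affinely_equivalent K L"
  shows "elementarily_equivalent (convex_structure K) (convex_structure L)"
proof -
  obtain f where f: "affine_bijection f" and L: "L = f ` K"
    using assms unfolding affinely_equivalent_def by blast
  have univ: "universe (convex_structure S) = S" for S :: "'a set"
    by (simp add: convex_structure_def)
  have "(\<forall>e. range e \<subseteq> K \<longrightarrow> sat (convex_structure K) e \<phi>) \<longleftrightarrow>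
        (\<forall>e. range e \<subseteq> f ` K \<longrightarrow> sat (convex_structure (f ` K)) e \<phi>)" for \<phi>
  proof (intro iffI allI impI)
    fix e :: "nat \<Rightarrow> 'a"
    assume all: "\<forall>e. range e \<subseteq> K \<longrightarrow> sat (convex_structure K) e \<phi>"
      and "range e \<subseteq> f ` K"
    then have "\<forall>i. \<exists>x\<in>K. e i = f x" by blast
    then obtain d where "\<And>i. d i \<in> K" "\<And>i. e i = f (d i)" by metis
    then have "range d \<subseteq> K" "e = f \<circ> d" by auto
    then show "sat (convex_structure (f ` K)) e \<phi>"
      using all sat_affine_bijection [OF f] by blast
  next
    fix e :: "nat \<Rightarrow> 'a"
    assume all: "\<forall>e. range e \<subseteq> f ` K \<longrightarrow> sat (convex_structure (f ` K)) e \<phi>"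
      and "range e \<subseteq> K"
    then have "range (f \<circ> e) \<subseteq> f ` K" by auto
    then show "sat (convex_structure K) e \<phi>"
      using all sat_affine_bijection [OF f] by blast
  qed
  then show ?thesis
    by (simp add: elementarily_equivalent_def models_def univ L)
qed

text \<open>The equality of classes in the theorem needs this. Compactness and convexity pass to
  affine images; injectivity of the linear part makes the image of the open ball the
  interior.\<close>

lemma solid_ellipsoid_imp_convex_body:
  fixes E :: "'a::euclidean_space set"
  assumes "solid_ellipsoid E"
  shows "convex_body E"
proof -
  obtain f :: "'a \<Rightarrow> 'a" and A b where "bij f" and A: "linear A" and f: "\<And>x. f x = A x + b" and E: "E = f ` cball 0 1"
    using assms unfolding solid_ellipsoid_def affine_bijection_def by metis
  have "inj A" using \<open>bij f\<close> f by (simp add: bij_def inj_def)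
  have E': "E = (+) b ` A ` cball 0 1"
    by (simp add: E image_image f add.commute)
  have "interior E = (+) b ` A ` ball 0 1"
    by (simp add: E' interior_translation interior_injective_linear_image [OF A \<open>inj A\<close>])
  moreover have "compact E" "convex E"
    using A by (auto simp: E' linear_conv_bounded_linear
        intro!: compact_translation compact_continuous_image linear_continuous_on
          convex_translation convex_linear_image)
  ultimately show ?thesis by (simp add: convex_body_def)
qed

theorem theorem7p3:
  assumes "CARD('n::finite) \<ge> 2"
  shows "(\<forall>K :: (real ^ 'n) set. convex_body K \<longrightarrow>
            (elementarily_equivalent (convex_structure K) (convex_structure (cball (0 :: real ^ 'n) 1))
               \<longleftrightarrow> affinely_equivalent K (cball 0 1)) \<and>
            (affinely_equivalent K (cball 0 1) \<longleftrightarrow> solid_ellipsoid K))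
       \<and> {K :: (real ^ 'n) set. convex_body K \<and>
            elementarily_equivalent (convex_structure K) (convex_structure (cball (0 :: real ^ 'n) 1))}
         = {E. solid_ellipsoid E}"
proof -
  \<comment> \<open>The implications close a circle: elementary equivalence gives an ellipsoid, an
    ellipsoid is affinely equivalent to the ball, and affine equivalence gives elementary
    equivalence.\<close>
  have "elementarily_equivalent (convex_structure K) (convex_structure (cball (0 :: real ^ 'n) 1))
      \<longleftrightarrow> solid_ellipsoid K" if "convex_body K" for K :: "(real ^ 'n) set"
    using that elementarily_equivalent_ball_imp_ellipsoid affinely_equivalent_ball_iff
      affinely_equivalent_imp_elementarily_equivalent by blast
  then show ?thesis
    using affinely_equivalent_ball_iff solid_ellipsoid_imp_convex_body by blast
qed

end
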